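(* Let $n\ge 1$ be an integer and let the ring $\mathbb{R}[x_1,\dots,x_n]$ be endowed with the topology of uniform convergence on $\mathbb{R}^n$. Then the topological stable rank of $\mathbb{R}[x_1,\dots,x_n]$ is equal to $n+1$.
   Context: $\mathbb{R}[x_1,\dots,x_n]$ is the ring of polynomials in $n$ variables with real coefficients, viewed as functions on $\mathbb{R}^n$. For a commutative unital ring $R$ and an integer $k\ge 1$, $U_k(R)$ denotes the set of invertible (unimodular) $k$-tuples, i.e. those $(f_1,\dots,f_k)\in R^k$ for which there exists $(x_1,\dots,x_k)\in R^k$ with $\sum_{j=1}^k x_jf_j=1$. If $R$ is endowed with a topology $\mathcal{T}$ (not assumed compatible with the algebraic operations), the topological stable rank of $(R,\mathcal{T})$ is the least integer $k\geq 1$ for which $U_k(R)$ is dense in $R^k$ (with the product topology), or $\infty$ if no such $k$ exists. In the topology of uniform convergence on $\mathbb{R}^n$, the basic neighbourhoods of $f$ are the sets $\{g\in\mathbb{R}[x_1,\dots,x_n]:\ \sup_{x\in\mathbb{R}^n}|f(x)-g(x)|<\varepsilon\}$, $\varepsilon>0$. *)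

theory Defs
  imports "HOL-Analysis.Analysis" "HOL-Algebra.Ring"
begin

text \<open>A \<open>k\<close>-tuple over \<open>R\<close> is an element of \<open>{..<k} \<rightarrow>\<^sub>E carrier R\<close>, which is also the
  underlying set of \<open>product_topology (\<lambda>_. T) {..<k}\<close> when \<open>T\<close> is a topology on \<open>carrier R\<close>.\<close>

definition unimodular_tuples :: "('a, 'b) ring_scheme \<Rightarrow> nat \<Rightarrow> (nat \<Rightarrow> 'a) set" where
  "unimodular_tuples R k =
     {f \<in> {..<k} \<rightarrow>\<^sub>E carrier R.
        \<exists>x \<in> {..<k} \<rightarrow>\<^sub>E carrier R. (\<Oplus>\<^bsub>R\<^esub>j\<in>{..<k}. x j \<otimes>\<^bsub>R\<^esub> f j) = \<one>\<^bsub>R\<^esub>}"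

definition unimodular_dense :: "('a, 'b) ring_scheme \<Rightarrow> 'a topology \<Rightarrow> nat \<Rightarrow> bool" where
  "unimodular_dense R T k \<longleftrightarrow>
     product_topology (\<lambda>_. T) {..<k} closure_of unimodular_tuples R k
       = ({..<k} \<rightarrow>\<^sub>E carrier R)"

definition topological_stable_rank :: "('a, 'b) ring_scheme \<Rightarrow> 'a topology \<Rightarrow> enat" where
  "topological_stable_rank R T =
     (if \<exists>k\<ge>1. unimodular_dense R T k
      then enat (LEAST k. k \<ge> 1 \<and> unimodular_dense R T k) else \<infinity>)"

definition polynomial_ring :: "(real ^ 'n \<Rightarrow> real) ring" where
  "polynomial_ring =
     \<lparr>carrier = {f. real_polynomial_function f},
      mult = (\<lambda>f g x. f x * g x), one = (\<lambda>_. 1),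
      zero = (\<lambda>_. 0), add = (\<lambda>f g x. f x + g x)\<rparr>"

text \<open>The supremum is taken in the extended reals, since the difference of two members of
  \<open>F\<close> need not be bounded.\<close>

definition uniform_nbhd :: "('a \<Rightarrow> real) set \<Rightarrow> ('a \<Rightarrow> real) \<Rightarrow> real \<Rightarrow> ('a \<Rightarrow> real) set" where
  "uniform_nbhd F f e = {g \<in> F. (SUP x. ereal \<bar>f x - g x\<bar>) < ereal e}"

definition uniform_convergence_topology :: "('a \<Rightarrow> real) set \<Rightarrow> ('a \<Rightarrow> real) topology" where
  "uniform_convergence_topology F =
     topology (\<lambda>U. U \<subseteq> F \<and> (\<forall>f\<in>U. \<exists>e>0. uniform_nbhd F f e \<subseteq> U))"

lemma uniform_nbhd_mono: "d \<le> e \<Longrightarrow> uniform_nbhd F f d \<subseteq> uniform_nbhd F f e"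
  by (auto simp: uniform_nbhd_def intro: less_le_trans)

lemma openin_uniform_convergence_topology:
  "openin (uniform_convergence_topology F) U \<longleftrightarrow>
     U \<subseteq> F \<and> (\<forall>f\<in>U. \<exists>e>0. uniform_nbhd F f e \<subseteq> U)"
proof -
  let ?L = "\<lambda>U. U \<subseteq> F \<and> (\<forall>f\<in>U. \<exists>e>0. uniform_nbhd F f e \<subseteq> U)"
  have "?L (S \<inter> T)" if S: "?L S" and T: "?L T" for S T
  proof (intro conjI ballI)
    show "S \<inter> T \<subseteq> F"
      using S by blast
    fix f assume f: "f \<in> S \<inter> T"
    obtain d where d: "d > 0" "uniform_nbhd F f d \<subseteq> S"
      using S f by blast
    obtain e where e: "e > 0" "uniform_nbhd F f e \<subseteq> T"
      using T f by blast
    have "uniform_nbhd F f (min d e) \<subseteq> S \<inter> T"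
      using d e uniform_nbhd_mono[of "min d e" d F f] uniform_nbhd_mono[of "min d e" e F f]
      by auto
    then show "\<exists>e>0. uniform_nbhd F f e \<subseteq> S \<inter> T"
      using d e by (intro exI[of _ "min d e"]) simp
  qed
  moreover have "?L (\<Union>K)" if K: "\<forall>U\<in>K. ?L U" for K
  proof (intro conjI ballI)
    show "\<Union>K \<subseteq> F"
      using K by blast
    fix f assume "f \<in> \<Union>K"
    then obtain U where U: "U \<in> K" "f \<in> U"
      by blast
    then obtain e where "e > 0" "uniform_nbhd F f e \<subseteq> U"
      using K by blast
    then show "\<exists>e>0. uniform_nbhd F f e \<subseteq> \<Union>K"
      using U by blast
  qed
  ultimately have "istopology ?L"
    unfolding istopology_def by blast
  then show ?thesis
    by (simp add: uniform_convergence_topology_def)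
qed

lemma topspace_uniform_convergence_topology [simp]:
  "topspace (uniform_convergence_topology F) = F"
proof
  show "topspace (uniform_convergence_topology F) \<subseteq> F"
    using openin_topspace[of "uniform_convergence_topology F"]
    unfolding openin_uniform_convergence_topology by (rule conjunct1)
  have "openin (uniform_convergence_topology F) F"
    unfolding openin_uniform_convergence_topology
    by (auto simp: uniform_nbhd_def intro: exI[of _ "1::real"])
  then show "F \<subseteq> topspace (uniform_convergence_topology F)"
    by (rule openin_subset)
qed

lemma openin_uniform_nbhd: "openin (uniform_convergence_topology F) (uniform_nbhd F f e)"
  unfolding openin_uniform_convergence_topology
proof (intro conjI ballI)
  show "uniform_nbhd F f e \<subseteq> F"
    by (auto simp: uniform_nbhd_def)
next
  fix g assume "g \<in> uniform_nbhd F f e"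
  then have lt: "(SUP x. ereal \<bar>f x - g x\<bar>) < ereal e"
    by (simp add: uniform_nbhd_def)
  obtain r where r: "(SUP x. ereal \<bar>f x - g x\<bar>) < ereal r" "ereal r < ereal e"
    using ereal_dense2[OF lt] by blast
  have fg: "\<bar>f x - g x\<bar> \<le> r" for x
    using SUP_lessD[OF r(1), of x] by simp
  have "uniform_nbhd F g ((e - r) / 2) \<subseteq> uniform_nbhd F f e"
  proof
    fix h assume h: "h \<in> uniform_nbhd F g ((e - r) / 2)"
    have gh: "\<bar>g x - h x\<bar> \<le> (e - r) / 2" for x
      using h SUP_lessD[of "\<lambda>x. ereal \<bar>g x - h x\<bar>" UNIV "ereal ((e - r) / 2)" x]
      by (simp add: uniform_nbhd_def)
    have "\<bar>f x - h x\<bar> \<le> r + (e - r) / 2" for x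
      using fg[of x] gh[of x] by linarith
    then have "(SUP x. ereal \<bar>f x - h x\<bar>) \<le> ereal (r + (e - r) / 2)"
      by (intro SUP_least) simp
    also have "\<dots> < ereal e"
      using r(2) by (simp add: field_simps)
    finally show "h \<in> uniform_nbhd F f e"
      using h by (simp add: uniform_nbhd_def)
  qed
  then show "\<exists>d>0. uniform_nbhd F g d \<subseteq> uniform_nbhd F f e"
    using r(2) by (intro exI[of _ "(e - r) / 2"]) auto
qed

lemma cring_polynomial_ring: "cring (polynomial_ring :: (real ^ 'n \<Rightarrow> real) ring)"
proof (intro cringI abelian_groupI comm_monoidI)
  fix f :: "real ^ 'n \<Rightarrow> real"
  assume "f \<in> carrier polynomial_ring"
  then show "\<exists>g\<in>carrier polynomial_ring. g \<oplus>\<^bsub>polynomial_ring\<^esub> f = \<zero>\<^bsub>polynomial_ring\<^esub>"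
    by (intro bexI[of _ "\<lambda>x. - f x"]) (auto simp: polynomial_ring_def)
qed (auto simp: polynomial_ring_def algebra_simps real_polynomial_function.intros)

end

theory Submission
  imports Defs
begin

text \<open>A polynomial bounded on \<open>\<real>\<^sup>n\<close> is constant, so uniform neighbours differ by constants. Hence a
  uniform perturbation of \<open>k \<le> n\<close> coordinate functions still has a common zero. Conversely,
  \<open>n + 1\<close> polynomials \<open>f\<^sub>j\<close> satisfy a nontrivial relation \<open>P(f) = 0\<close> by a dimension count. Choose
  arbitrarily small constants \<open>c\<^sub>j\<close> with \<open>P(c) \<noteq> 0\<close>: as \<open>P(f) - P(c)\<close> lies in the ideal generated by
  the \<open>f\<^sub>j - c\<^sub>j\<close>, so does the unit \<open>P(c)\<close>.\<close>

section \<open>Linear systems and nonvanishing of polynomials\<close>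

text \<open>Gaussian elimination, by induction on the set \<open>B\<close> of equations: an equation
  with only zero coefficients is dropped; any other one eliminates one unknown, which preserves the
  strict inequality between the cardinalities.\<close>

lemma homogeneous_system_nontrivial_solution:
  fixes M :: "'a \<Rightarrow> 'b \<Rightarrow> real"
  assumes "finite B" "finite A" "card B < card A"
  shows "\<exists>l. (\<exists>a\<in>A. l a \<noteq> 0) \<and> (\<forall>b\<in>B. (\<Sum>a\<in>A. l a * M a b) = 0)"
  using assms
proof (induction B arbitrary: A M rule: finite_induct)
  case empty
  then have "A \<noteq> {}" by auto
  then show ?case by (intro exI[of _ "\<lambda>_. 1"]) auto
next
  case (insert b0 B)
  show ?case
  proof (cases "\<forall>a\<in>A. M a b0 = 0")
    case True
    have "card B < card A" using insert by simp
    from insert.IH[OF insert.prems(1) this, of M] True show ?thesis by auto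
  next
    case False
    then obtain a0 where a0: "a0 \<in> A" "M a0 b0 \<noteq> 0" by blast
    let ?A = "A - {a0}"
    \<comment> \<open>The pivot is \<open>M a0 b0\<close>. \<open>?N\<close> is the system left
      after subtracting multiples of row \<open>a0\<close>, so that its column \<open>b0\<close>
      vanishes.\<close>
    let ?N = "\<lambda>a b. M a b - M a b0 / M a0 b0 * M a0 b"
    have "card B < card ?A" "finite ?A" using insert a0 by simp_all
    from insert.IH[OF this(2,1), of ?N] obtain l where
      l: "\<exists>a\<in>?A. l a \<noteq> 0" "\<And>b. b \<in> B \<Longrightarrow> (\<Sum>a\<in>?A. l a * ?N a b) = 0" by blast
    define s where "s = (\<Sum>a\<in>?A. l a * M a b0)"
    \<comment> \<open>Back substitution: this value at \<open>a0\<close> makes equation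
      \<open>b0\<close> hold and turns every other equation of the original system into the reduced
      one.\<close>
    define l' where "l' = l(a0 := - s / M a0 b0)"
    have eq: "(\<Sum>a\<in>A. l' a * M a b) = (\<Sum>a\<in>?A. l a * ?N a b)" for b
    proof -
      have "(\<Sum>a\<in>A. l' a * M a b) = l' a0 * M a0 b + (\<Sum>a\<in>?A. l' a * M a b)"
        using insert.prems a0 by (simp add: sum.remove)
      also have "(\<Sum>a\<in>?A. l' a * M a b) = (\<Sum>a\<in>?A. l a * M a b)"
        by (rule sum.cong) (auto simp: l'_def)
      also have "l' a0 * M a0 b = - (\<Sum>a\<in>?A. l a * (M a b0 / M a0 b0 * M a0 b))"
        by (simp add: l'_def s_def sum_distrib_right sum_divide_distrib mult.assoc)
      finally show ?thesis by (simp add: right_diff_distrib sum_subtractf)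
    qed
    have "(\<Sum>a\<in>?A. l a * ?N a b0) = 0" using a0 by simp
    then have "\<forall>b\<in>insert b0 B. (\<Sum>a\<in>A. l' a * M a b) = 0" using l(2) eq by auto
    moreover have "\<exists>a\<in>A. l' a \<noteq> 0" using l(1) by (auto simp: l'_def)
    ultimately show ?thesis by blast
  qed
qed

text \<open>A nonzero polynomial does not vanish on any small cube around 0. One variable is added
  at a time: the other values are fixed so that some coefficient in the new variable is nonzero, and
  then only finitely many values of that variable are excluded.\<close>

lemma multivariate_polynomial_nonvanishing:
  fixes l :: "('i \<Rightarrow> nat) \<Rightarrow> real"
  assumes "finite J" "e > 0" "\<exists>a \<in> J \<rightarrow>\<^sub>E {..m}. l a \<noteq> 0"
  shows "\<exists>c. (\<forall>j\<in>J. \<bar>c j\<bar> < e) \<and> (\<Sum>a\<in>J \<rightarrow>\<^sub>E {..m}. l a * (\<Prod>j\<in>J. c j ^ a j)) \<noteq> 0"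
  using assms(1,3)
proof (induction J arbitrary: l rule: finite_induct)
  case empty
  then show ?case by auto
next
  case (insert j J)
  from insert.prems obtain a where a: "a \<in> insert j J \<rightarrow>\<^sub>E {..m}" "l a \<noteq> 0" by blast
  \<comment> \<open>\<open>L i\<close> collects the coefficients of the terms of degree
    \<open>i\<close> in the new variable \<open>j\<close>. The induction hypothesis is applied to
    degree \<open>a j\<close>, where a nonzero coefficient is known to occur.\<close>
  define L where "L i b = l (b(j := i))" for i b
  have "restrict a J \<in> J \<rightarrow>\<^sub>E {..m}" using a(1) by auto
  moreover have "(restrict a J)(j := a j) = a"
    using a(1) by (auto simp: fun_eq_iff PiE_def extensional_def)
  ultimately have "\<exists>b \<in> J \<rightarrow>\<^sub>E {..m}. L (a j) b \<noteq> 0" using a(2) by (metis L_def)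
  from insert.IH[OF this] obtain c where c: "\<forall>i\<in>J. \<bar>c i\<bar> < e"
    "(\<Sum>b\<in>J \<rightarrow>\<^sub>E {..m}. L (a j) b * (\<Prod>i\<in>J. c i ^ b i)) \<noteq> 0" by blast
  define q where "q i = (\<Sum>b\<in>J \<rightarrow>\<^sub>E {..m}. L i b * (\<Prod>i\<in>J. c i ^ b i))" for i
  have "q (a j) \<noteq> 0" "a j \<le> m" using a(1) c(2) by (auto simp: q_def)
  then have "finite {t. (\<Sum>i\<le>m. q i * t ^ i) = 0}"
    using polyfun_finite_roots[of q m] by blast
  moreover have "infinite {0<..<e}" using assms(2) by simp
  ultimately obtain t where t: "t \<in> {0<..<e}" "(\<Sum>i\<le>m. q i * t ^ i) \<noteq> 0"
    by (metis (mono_tags, lifting) finite_subset mem_Collect_eq subsetI)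
  \<comment> \<open>Each exponent vector splits into its entry \<open>i\<close> at \<open>j\<close>
    and the rest \<open>b\<close>, which regroups the sum as the one-variable polynomial with
    coefficients \<open>q i\<close> evaluated at \<open>t\<close>.\<close>
  have "(\<Sum>a\<in>insert j J \<rightarrow>\<^sub>E {..m}. l a * (\<Prod>i\<in>insert j J. (c(j := t)) i ^ a i))
      = (\<Sum>(i, b)\<in>{..m} \<times> (J \<rightarrow>\<^sub>E {..m}). L i b * (t ^ i * (\<Prod>i\<in>J. c i ^ b i)))"
    unfolding PiE_insert_eq
  proof (subst sum.reindex)
    show "inj_on (\<lambda>(y, g). g(j := y)) ({..m} \<times> (J \<rightarrow>\<^sub>E {..m}))"
      using insert.hyps by (auto intro!: inj_combinator)
    have "(\<Prod>i\<in>J. (if i = j then t else c i) ^ (if i = j then k else b i)) = (\<Prod>i\<in>J. c i ^ b i)"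
      for k b
      using insert.hyps by (intro prod.cong) auto
    then show "sum ((\<lambda>a. l a * (\<Prod>i\<in>insert j J. (c(j := t)) i ^ a i)) \<circ> (\<lambda>(y, g). g(j := y)))
         ({..m} \<times> (J \<rightarrow>\<^sub>E {..m})) =
       (\<Sum>(i, b)\<in>{..m} \<times> (J \<rightarrow>\<^sub>E {..m}). L i b * (t ^ i * (\<Prod>i\<in>J. c i ^ b i)))"
      using insert.hyps by (intro sum.cong) (auto simp: L_def)
  qed
  also have "\<dots> = (\<Sum>i\<le>m. q i * t ^ i)"
    by (simp add: sum.cartesian_product[symmetric] q_def sum_distrib_left sum_distrib_right mult_ac)
  finally show ?case using t c(1) insert.hyps
    by (intro exI[of _ "c(j := t)"]) auto
qed

section \<open>Polynomials with bounded exponents\<close>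

definition monomial :: "('n \<Rightarrow> nat) \<Rightarrow> real ^ 'n \<Rightarrow> real" where
  "monomial b x = (\<Prod>i\<in>UNIV. x $ i ^ b i)"

definition exponents_le :: "nat \<Rightarrow> ('n \<Rightarrow> nat) set" where
  "exponents_le d = UNIV \<rightarrow>\<^sub>E {..d}"

text \<open>The degree is bounded in each variable separately rather than in total: the exponents
  then form a box, and counting the spanning monomials is immediate.\<close>

definition coord_degree_le :: "nat \<Rightarrow> (real ^ 'n \<Rightarrow> real) set" where
  "coord_degree_le d = {f. \<exists>c. \<forall>x. f x = (\<Sum>b\<in>exponents_le d. c b * monomial b x)}"

lemma exponents_le_iff: "b \<in> exponents_le d \<longleftrightarrow> (\<forall>i. b i \<le> d)"
  by (auto simp: exponents_le_def PiE_def Pi_def)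

lemma finite_exponents_le [simp]: "finite (exponents_le d :: ('n::finite \<Rightarrow> nat) set)"
  by (simp add: exponents_le_def finite_PiE)

lemma card_exponents_le: "card (exponents_le d :: ('n::finite \<Rightarrow> nat) set) = Suc d ^ CARD('n)"
  by (simp add: exponents_le_def card_PiE)

lemma monomial_in_coord_degree_le:
  assumes "b \<in> exponents_le d"
  shows "monomial b \<in> coord_degree_le d"
  unfolding coord_degree_le_def
  using assms by (auto intro!: exI[of _ "\<lambda>b'. if b' = b then 1 else 0"]
      simp: if_distrib[of "\<lambda>x. x * _"] sum.delta cong: if_cong)

lemma coord_degree_le_add:
  assumes "f \<in> coord_degree_le d" "g \<in> coord_degree_le d"
  shows "(\<lambda>x. f x + g x) \<in> coord_degree_le d"
proof -
  obtain c c' where "\<And>x. f x = (\<Sum>b\<in>exponents_le d. c b * monomial b x)"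
    "\<And>x. g x = (\<Sum>b\<in>exponents_le d. c' b * monomial b x)"
    using assms unfolding coord_degree_le_def by blast
  then show ?thesis unfolding coord_degree_le_def
    by (auto intro!: exI[of _ "\<lambda>b. c b + c' b"] simp: distrib_right sum.distrib)
qed

lemma coord_degree_le_cmult:
  assumes "f \<in> coord_degree_le d"
  shows "(\<lambda>x. r * f x) \<in> coord_degree_le d"
proof -
  obtain c where "\<And>x. f x = (\<Sum>b\<in>exponents_le d. c b * monomial b x)"
    using assms unfolding coord_degree_le_def by blast
  then show ?thesis unfolding coord_degree_le_def
    by (auto intro!: exI[of _ "\<lambda>b. r * c b"] simp: sum_distrib_left mult_ac)
qed

lemma coord_degree_le_sum:
  assumes "\<And>i. i \<in> I \<Longrightarrow> f i \<in> coord_degree_le d"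
  shows "(\<lambda>x. \<Sum>i\<in>I. f i x) \<in> coord_degree_le d"
  using assms
proof (induction I rule: infinite_finite_induct)
  case (insert i I)
  then show ?case by (simp add: coord_degree_le_add)
qed (auto simp: coord_degree_le_def intro: exI[of _ "\<lambda>_. 0"])

lemma coord_degree_le_mult:
  assumes "f \<in> coord_degree_le d" "g \<in> coord_degree_le e"
  shows "(\<lambda>x. f x * g x) \<in> coord_degree_le (d + e)"
proof -
  obtain c c' where fg: "\<And>x. f x = (\<Sum>b\<in>exponents_le d. c b * monomial b x)"
    "\<And>x. g x = (\<Sum>b\<in>exponents_le e. c' b * monomial b x)"
    using assms unfolding coord_degree_le_def by blast
  have "(\<lambda>x. f x * g x) = (\<lambda>x. \<Sum>b\<in>exponents_le d. \<Sum>b'\<in>exponents_le e.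
      (c b * c' b') * monomial (\<lambda>i. b i + b' i) x)"
    unfolding fg sum_product monomial_def power_add prod.distrib by (simp add: mult_ac)
  also have "\<dots> \<in> coord_degree_le (d + e)"
    by (intro coord_degree_le_sum coord_degree_le_cmult monomial_in_coord_degree_le)
      (auto simp: exponents_le_iff add_mono)
  finally show ?thesis .
qed

lemma coord_degree_le_mono:
  assumes "f \<in> coord_degree_le d" "d \<le> e"
  shows "f \<in> coord_degree_le e"
proof -
  obtain c where f: "\<And>x. f x = (\<Sum>b\<in>exponents_le d. c b * monomial b x)"
    using assms unfolding coord_degree_le_def by blast
  have "(\<lambda>x. \<Sum>b\<in>exponents_le d. c b * monomial b x) \<in> coord_degree_le e"
    using assms(2) by (intro coord_degree_le_sum coord_degree_le_cmult monomial_in_coord_degree_le)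
      (auto simp: exponents_le_iff intro: order_trans)
  then show ?thesis by (simp flip: f)
qed

lemma coord_degree_le_const: "(\<lambda>_. r) \<in> coord_degree_le d"
proof -
  have "(\<lambda>x. r * monomial (\<lambda>_. 0) x) \<in> coord_degree_le d"
    by (intro coord_degree_le_cmult monomial_in_coord_degree_le) (simp add: exponents_le_iff)
  then show ?thesis by (simp add: monomial_def)
qed

lemma coord_degree_le_power:
  assumes "f \<in> coord_degree_le d"
  shows "(\<lambda>x. f x ^ k) \<in> coord_degree_le (k * d)"
proof (induction k)
  case (Suc k)
  show ?case using coord_degree_le_mult[OF assms Suc] by simp
qed (simp add: coord_degree_le_const)

lemma coord_degree_le_prod:
  assumes "finite J" "\<And>j. j \<in> J \<Longrightarrow> f j \<in> coord_degree_le d"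
  shows "(\<lambda>x. \<Prod>j\<in>J. f j x) \<in> coord_degree_le (card J * d)"
  using assms
proof (induction J rule: finite_induct)
  case (insert j J)
  then show ?case using coord_degree_le_mult[of "f j" d "\<lambda>x. \<Prod>j\<in>J. f j x"] by simp
qed (simp add: coord_degree_le_const)

lemma real_polynomial_function_coord_degree_le:
  fixes f :: "real ^ 'n \<Rightarrow> real"
  assumes "real_polynomial_function f"
  shows "\<exists>d. f \<in> coord_degree_le d"
  using assms
proof (induction rule: real_polynomial_function.induct)
  case (linear f)
  \<comment> \<open>The linear generators of \<open>real_polynomial_function\<close> are arbitrary
    functionals. Expansion in the standard basis writes them through the coordinates, each of which
    is the monomial whose exponent vector is 1 at \<open>i\<close> and 0 elsewhere.\<close>
  have "f x = (\<Sum>i\<in>UNIV. f (axis i 1) * monomial (\<lambda>k. if k = i then 1 else 0) x)" for x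
  proof -
    have "f x = f (\<Sum>i\<in>UNIV. x $ i *\<^sub>R axis i 1)"
      by (simp add: basis_expansion flip: scalar_mult_eq_scaleR)
    also have "\<dots> = (\<Sum>i\<in>UNIV. x $ i * f (axis i 1))"
      using linear by (simp add: bounded_linear.linear linear_sum linear_cmul)
    also have "\<dots> = (\<Sum>i\<in>UNIV. f (axis i 1) * monomial (\<lambda>k. if k = i then 1 else 0) x)"
      by (simp add: monomial_def if_distrib[of "\<lambda>k. _ ^ k"] prod.delta mult.commute cong: if_cong)
    finally show ?thesis .
  qed
  then have "f = (\<lambda>x. \<Sum>i\<in>UNIV. f (axis i 1) * monomial (\<lambda>k. if k = i then 1 else 0) x)"
    by blast
  also have "\<dots> \<in> coord_degree_le 1"
    by (intro coord_degree_le_sum coord_degree_le_cmult monomial_in_coord_degree_le)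
      (simp add: exponents_le_iff)
  finally show ?case by blast
next
  case (const c)
  then show ?case using coord_degree_le_const by blast
next
  case (add f g)
  then obtain d e where "f \<in> coord_degree_le d" "g \<in> coord_degree_le e" by blast
  then show ?case
    by (intro exI[of _ "max d e"] coord_degree_le_add) (auto elim: coord_degree_le_mono)
next
  case (mult f g)
  then show ?case using coord_degree_le_mult by blast
qed

section \<open>Algebraic dependence of more than n polynomials\<close>

text \<open>The products of powers of the \<open>f j\<close> with exponents at most \<open>m\<close>
  are indexed by \<open>Suc m ^ k\<close> vectors, while they lie in a span of
  \<open>Suc E ^ CARD('n)\<close> monomials with \<open>E\<close> linear in \<open>m\<close>. As
  \<open>k > CARD('n)\<close>, the products outnumber the monomials for large \<open>m\<close>,
  which forces a linear relation.\<close>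

lemma algebraically_dependent_polynomials:
  fixes f :: "nat \<Rightarrow> real ^ 'n \<Rightarrow> real"
  assumes "\<And>j. j < k \<Longrightarrow> real_polynomial_function (f j)" and k: "k > CARD('n)"
  shows "\<exists>m l. (\<exists>a \<in> {..<k} \<rightarrow>\<^sub>E {..m}. l a \<noteq> 0) \<and>
    (\<forall>x. (\<Sum>a\<in>{..<k} \<rightarrow>\<^sub>E {..m}. l a * (\<Prod>j<k. f j x ^ a j)) = 0)"
proof -
  have "\<forall>j. \<exists>d. j < k \<longrightarrow> f j \<in> coord_degree_le d"
    using assms real_polynomial_function_coord_degree_le by blast
  then obtain d where d: "\<And>j. j < k \<Longrightarrow> f j \<in> coord_degree_le (d j)" by metis
  define D where "D = (\<Sum>j<k. d j)"
  have D: "f j \<in> coord_degree_le D" if "j < k" for j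
    using d[OF that] that by (rule_tac coord_degree_le_mono) (auto simp: D_def intro: member_le_sum)
  \<comment> \<open>With these constants \<open>Suc E \<le> C * Suc m\<close>, and \<open>m\<close>
    is chosen as the power \<open>C ^ CARD('n)\<close> so that the factor contributed by
    \<open>C\<close> is exactly \<open>m\<close>, hence less than \<open>Suc m\<close>.\<close>
  define C where "C = Suc (k * D)"
  define m where "m = C ^ CARD('n)"
  define A where "A = ({..<k} \<rightarrow>\<^sub>E {..m})"
  define E where "E = k * (m * D)"
  have fin: "finite A" by (simp add: A_def finite_PiE)
  have "card (exponents_le E :: ('n \<Rightarrow> nat) set) = Suc E ^ CARD('n)"
    by (rule card_exponents_le)
  also have "\<dots> \<le> (C * Suc m) ^ CARD('n)"
    by (intro power_mono) (auto simp: E_def C_def algebra_simps)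
  also have "\<dots> = m * Suc m ^ CARD('n)"
    unfolding power_mult_distrib by (simp add: m_def)
  also have "\<dots> < Suc m ^ Suc CARD('n)" by simp
  also have "\<dots> \<le> Suc m ^ k" using k by (intro power_increasing) auto
  also have "\<dots> = card A" by (simp add: A_def card_PiE)
  finally have lt: "card (exponents_le E :: ('n \<Rightarrow> nat) set) < card A" .
  have "(\<lambda>x. \<Prod>j<k. f j x ^ a j) \<in> coord_degree_le E" if "a \<in> A" for a
  proof -
    have "(\<lambda>x. f j x ^ a j) \<in> coord_degree_le (m * D)" if "j < k" for j
      using that \<open>a \<in> A\<close> by (intro coord_degree_le_mono[OF coord_degree_le_power[OF D]])
        (auto simp: A_def)
    then show ?thesis
      using coord_degree_le_prod[of "{..<k}" "\<lambda>j x. f j x ^ a j" "m * D"] by (simp add: E_def)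
  qed
  then have "\<forall>a. \<exists>M. a \<in> A \<longrightarrow>
      (\<forall>x. (\<Prod>j<k. f j x ^ a j) = (\<Sum>b\<in>exponents_le E. M b * monomial b x))"
    unfolding coord_degree_le_def by blast
  then obtain M where M: "\<And>a x. a \<in> A \<Longrightarrow>
      (\<Prod>j<k. f j x ^ a j) = (\<Sum>b\<in>exponents_le E. M a b * monomial b x)" by metis
  \<comment> \<open>The unknowns are the weights of the products, with one equation for each
    monomial: its total coefficient must vanish.\<close>
  obtain l where l: "\<exists>a\<in>A. l a \<noteq> 0"
    "\<And>b. b \<in> (exponents_le E :: ('n \<Rightarrow> nat) set) \<Longrightarrow> (\<Sum>a\<in>A. l a * M a b) = 0"
    using homogeneous_system_nontrivial_solution[OF finite_exponents_le fin lt, of M] by blast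
  have "(\<Sum>a\<in>A. l a * (\<Prod>j<k. f j x ^ a j)) = 0" for x
  proof -
    have "(\<Sum>a\<in>A. l a * (\<Prod>j<k. f j x ^ a j))
        = (\<Sum>a\<in>A. \<Sum>b\<in>exponents_le E. l a * M a b * monomial b x)"
      by (intro sum.cong) (simp_all add: M sum_distrib_left mult_ac)
    also have "\<dots> = (\<Sum>b\<in>exponents_le E. (\<Sum>a\<in>A. l a * M a b) * monomial b x)"
      by (subst sum.swap) (simp add: sum_distrib_right)
    finally show ?thesis by (simp add: l(2))
  qed
  with l(1) show ?thesis unfolding A_def by blast
qed

section \<open>Congruences modulo the ideal generated by a tuple\<close>

text \<open>This is the ideal generated by \<open>g 0\<close>, ..., \<open>g (k - 1)\<close>,
  written pointwise so that sums and products need no abstract ring operations.\<close>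

definition polynomial_combinations :: "nat \<Rightarrow> (nat \<Rightarrow> real ^ 'n \<Rightarrow> real) \<Rightarrow> (real ^ 'n \<Rightarrow> real) set" where
  "polynomial_combinations k g =
     {h. \<exists>y. (\<forall>j<k. real_polynomial_function (y j)) \<and> (\<forall>x. h x = (\<Sum>j<k. y j x * g j x))}"

lemma polynomial_combinations_add:
  assumes "f \<in> polynomial_combinations k g" "h \<in> polynomial_combinations k g"
  shows "(\<lambda>x. f x + h x) \<in> polynomial_combinations k g"
proof -
  obtain y z where "\<forall>j<k. real_polynomial_function (y j)" "\<And>x. f x = (\<Sum>j<k. y j x * g j x)"
    "\<forall>j<k. real_polynomial_function (z j)" "\<And>x. h x = (\<Sum>j<k. z j x * g j x)"
    using assms unfolding polynomial_combinations_def by blast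
  then show ?thesis unfolding polynomial_combinations_def
    by (auto intro!: exI[of _ "\<lambda>j x. y j x + z j x"] real_polynomial_function.intros(3)
        simp: distrib_right sum.distrib)
qed

lemma polynomial_combinations_mult:
  assumes "real_polynomial_function p" "f \<in> polynomial_combinations k g"
  shows "(\<lambda>x. p x * f x) \<in> polynomial_combinations k g"
proof -
  obtain y where "\<forall>j<k. real_polynomial_function (y j)" "\<And>x. f x = (\<Sum>j<k. y j x * g j x)"
    using assms unfolding polynomial_combinations_def by blast
  then show ?thesis using assms(1) unfolding polynomial_combinations_def
    by (auto intro!: exI[of _ "\<lambda>j x. p x * y j x"] real_polynomial_function.intros(4)
        simp: sum_distrib_left mult_ac)
qed

lemma zero_in_polynomial_combinations: "(\<lambda>_. 0) \<in> polynomial_combinations k g"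
  unfolding polynomial_combinations_def
  by (auto intro!: exI[of _ "\<lambda>_ _. 0"] real_polynomial_function.intros)

lemma generator_in_polynomial_combinations:
  assumes "j < k"
  shows "g j \<in> polynomial_combinations k g"
  unfolding polynomial_combinations_def
  using assms by (auto intro!: exI[of _ "\<lambda>i _. if i = j then 1 else 0"]
      real_polynomial_function.intros simp: if_distrib[of "\<lambda>x. x * _"] sum.delta cong: if_cong)

lemma polynomial_combinations_sum:
  assumes "\<And>i. i \<in> I \<Longrightarrow> f i \<in> polynomial_combinations k g"
  shows "(\<lambda>x. \<Sum>i\<in>I. f i x) \<in> polynomial_combinations k g"
  using assms by (induction I rule: infinite_finite_induct)
    (simp_all add: zero_in_polynomial_combinations polynomial_combinations_add)

text \<open>Membership of a difference in the ideal is read as a congruence. Congruences multiply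
  because fh - uv = f(h - v) + v(f - u).\<close>

lemma polynomial_combinations_diff_mult:
  assumes "real_polynomial_function f" "real_polynomial_function v"
    and "(\<lambda>x. f x - u x) \<in> polynomial_combinations k g"
    and "(\<lambda>x. h x - v x) \<in> polynomial_combinations k g"
  shows "(\<lambda>x. f x * h x - u x * v x) \<in> polynomial_combinations k g"
proof -
  have "(\<lambda>x. f x * h x - u x * v x) = (\<lambda>x. f x * (h x - v x) + v x * (f x - u x))"
    by (simp add: fun_eq_iff algebra_simps)
  then show ?thesis
    by (simp add: assms polynomial_combinations_add polynomial_combinations_mult)
qed

lemma polynomial_combinations_diff_power:
  assumes "real_polynomial_function f" and "(\<lambda>x. f x - c) \<in> polynomial_combinations k g"
  shows "(\<lambda>x. f x ^ i - c ^ i) \<in> polynomial_combinations k g"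
proof (induction i)
  case (Suc i)
  then show ?case
    using polynomial_combinations_diff_mult[OF assms(1) _ assms(2), of "\<lambda>_. c ^ i"]
    by (simp add: real_polynomial_function.intros)
qed (simp add: zero_in_polynomial_combinations)

lemma polynomial_combinations_diff_prod:
  assumes "finite J" "\<And>j. j \<in> J \<Longrightarrow> real_polynomial_function (f j)"
    and "\<And>j. j \<in> J \<Longrightarrow> (\<lambda>x. f j x - c j) \<in> polynomial_combinations k g"
  shows "(\<lambda>x. (\<Prod>j\<in>J. f j x) - (\<Prod>j\<in>J. c j)) \<in> polynomial_combinations k g"
  using assms
proof (induction J rule: finite_induct)
  case (insert j J)
  then show ?case
    using polynomial_combinations_diff_mult[of "f j" "\<lambda>_. \<Prod>j\<in>J. c j" "\<lambda>_. c j" k g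
        "\<lambda>x. \<Prod>j\<in>J. f j x"]
    by (simp add: real_polynomial_function.intros)
qed (simp add: zero_in_polynomial_combinations)

lemma one_in_polynomial_combinations_small_shift:
  fixes f :: "nat \<Rightarrow> real ^ 'n \<Rightarrow> real"
  assumes poly: "\<And>j. j < k \<Longrightarrow> real_polynomial_function (f j)" and "k > CARD('n)" "e > 0"
  shows "\<exists>c. (\<forall>j<k. \<bar>c j\<bar> < e) \<and> (\<lambda>_. 1) \<in> polynomial_combinations k (\<lambda>j x. f j x - c j)"
proof -
  obtain m l where l: "\<exists>a \<in> {..<k} \<rightarrow>\<^sub>E {..m}. l a \<noteq> 0"
    "\<And>x. (\<Sum>a\<in>{..<k} \<rightarrow>\<^sub>E {..m}. l a * (\<Prod>j<k. f j x ^ a j)) = 0"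
    using algebraically_dependent_polynomials[of k f] poly assms(2) by blast
  obtain c where c: "\<forall>j\<in>{..<k}. \<bar>c j\<bar> < e"
    "(\<Sum>a\<in>{..<k} \<rightarrow>\<^sub>E {..m}. l a * (\<Prod>j<k. c j ^ a j)) \<noteq> 0"
    using multivariate_polynomial_nonvanishing[OF finite_lessThan assms(3) l(1)] by blast
  define P where "P = (\<Sum>a\<in>{..<k} \<rightarrow>\<^sub>E {..m}. l a * (\<Prod>j<k. c j ^ a j))"
  let ?I = "polynomial_combinations k (\<lambda>j x. f j x - c j)"
  \<comment> \<open>Modulo the ideal each \<open>f j\<close> is congruent to the constant
    \<open>c j\<close>, since \<open>f j - c j\<close> is a generator; this passes to every product
    of powers.\<close>
  have "(\<lambda>x. (\<Prod>j<k. f j x ^ a j) - (\<Prod>j<k. c j ^ a j)) \<in> ?I" for a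
    by (intro polynomial_combinations_diff_prod polynomial_combinations_diff_power)
      (auto intro: poly generator_in_polynomial_combinations[of _ k "\<lambda>j x. f j x - c j"]
        real_polynomial_function_power)
  then have "(\<lambda>x. \<Sum>a\<in>{..<k} \<rightarrow>\<^sub>E {..m}. l a * ((\<Prod>j<k. f j x ^ a j) - (\<Prod>j<k. c j ^ a j))) \<in> ?I"
    by (intro polynomial_combinations_sum polynomial_combinations_mult)
      (auto intro: real_polynomial_function.intros)
  \<comment> \<open>The relation \<open>l(2)\<close> cancels the part containing the
    \<open>f j\<close>, so the ideal contains the nonzero constant \<open>- P\<close>, which is a
    unit.\<close>
  also have "(\<lambda>x. \<Sum>a\<in>{..<k} \<rightarrow>\<^sub>E {..m}. l a * ((\<Prod>j<k. f j x ^ a j) - (\<Prod>j<k. c j ^ a j)))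
      = (\<lambda>_. - P)"
    by (simp add: right_diff_distrib sum_subtractf l(2) P_def)
  finally have "(\<lambda>x. (- 1 / P) * (- P)) \<in> ?I"
    by (intro polynomial_combinations_mult real_polynomial_function.intros)
  then show ?thesis using c by (auto simp: P_def)
qed

section \<open>Unimodularity in the polynomial ring, pointwise\<close>

lemma finsum_polynomial_ring:
  assumes "finite I" "\<And>i. i \<in> I \<Longrightarrow> real_polynomial_function (h i)"
  shows "(\<Oplus>\<^bsub>polynomial_ring\<^esub>i\<in>I. h i) = (\<lambda>x. \<Sum>i\<in>I. h i x)"
proof -
  interpret cring "polynomial_ring :: (real ^ 'n \<Rightarrow> real) ring"
    by (rule cring_polynomial_ring)
  show ?thesis using assms
  proof (induction I rule: finite_induct)
    case empty
    show ?case unfolding finsum_empty by (simp add: polynomial_ring_def)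
  next
    case (insert i I)
    then have "h \<in> I \<rightarrow> carrier polynomial_ring" "h i \<in> carrier polynomial_ring"
      by (auto simp: polynomial_ring_def)
    with insert show ?case by (simp add: finsum_insert) (simp add: polynomial_ring_def)
  qed
qed

lemma unimodular_tuples_polynomial_ring:
  fixes g :: "nat \<Rightarrow> real ^ 'n \<Rightarrow> real"
  assumes g: "g \<in> {..<k} \<rightarrow>\<^sub>E carrier polynomial_ring"
  shows "g \<in> unimodular_tuples polynomial_ring k \<longleftrightarrow> (\<lambda>_. 1) \<in> polynomial_combinations k g"
proof -
  have *: "(\<Oplus>\<^bsub>polynomial_ring\<^esub>j\<in>{..<k}. y j \<otimes>\<^bsub>polynomial_ring\<^esub> g j) = (\<lambda>x. \<Sum>j<k. y j x * g j x)"
    if "\<forall>j<k. real_polynomial_function (y j)" for y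
  proof (subst finsum_polynomial_ring)
    show "real_polynomial_function (y j \<otimes>\<^bsub>polynomial_ring\<^esub> g j)" if "j \<in> {..<k}" for j
      using g that \<open>\<forall>j<k. real_polynomial_function (y j)\<close>
      by (auto simp: polynomial_ring_def PiE_def Pi_def intro: real_polynomial_function.intros)
  qed (simp_all add: polynomial_ring_def)
  show ?thesis
  proof
    assume "g \<in> unimodular_tuples polynomial_ring k"
    then obtain y where "y \<in> {..<k} \<rightarrow>\<^sub>E carrier polynomial_ring" and
      1: "(\<Oplus>\<^bsub>polynomial_ring\<^esub>j\<in>{..<k}. y j \<otimes>\<^bsub>polynomial_ring\<^esub> g j) = \<one>\<^bsub>polynomial_ring\<^esub>"
      by (auto simp: unimodular_tuples_def)
    then have y: "\<forall>j<k. real_polynomial_function (y j)" by (auto simp: polynomial_ring_def)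
    from 1 have "(\<lambda>x. \<Sum>j<k. y j x * g j x) = (\<lambda>_. 1)"
      unfolding *[OF y] by (simp add: polynomial_ring_def)
    with y show "(\<lambda>_. 1) \<in> polynomial_combinations k g"
      unfolding polynomial_combinations_def by (auto simp: fun_eq_iff)
  next
    assume "(\<lambda>_. 1) \<in> polynomial_combinations k g"
    then obtain y where y: "\<forall>j<k. real_polynomial_function (y j)" "\<And>x. 1 = (\<Sum>j<k. y j x * g j x)"
      unfolding polynomial_combinations_def by blast
    \<comment> \<open>Tuples over the ring are extensional, whereas \<open>y\<close> may take any
      values from index \<open>k\<close> on.\<close>
    let ?y = "restrict y {..<k}"
    have "(\<Oplus>\<^bsub>polynomial_ring\<^esub>j\<in>{..<k}. ?y j \<otimes>\<^bsub>polynomial_ring\<^esub> g j) = (\<lambda>x. \<Sum>j<k. ?y j x * g j x)"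
      by (rule *) (simp add: y(1))
    also have "\<dots> = \<one>\<^bsub>polynomial_ring\<^esub>" by (simp add: polynomial_ring_def flip: y(2))
    finally have "(\<Oplus>\<^bsub>polynomial_ring\<^esub>j\<in>{..<k}. ?y j \<otimes>\<^bsub>polynomial_ring\<^esub> g j) = \<one>\<^bsub>polynomial_ring\<^esub>" .
    moreover have "?y \<in> {..<k} \<rightarrow>\<^sub>E carrier polynomial_ring"
      using y(1) by (auto simp: polynomial_ring_def)
    ultimately show "g \<in> unimodular_tuples polynomial_ring k"
      using g unfolding unimodular_tuples_def by blast
  qed
qed

section \<open>No density for at most n entries\<close>

text \<open>Restricted to the line through 0 and \<open>x\<close>, the function is a bounded
  polynomial in one variable. A nonzero coefficient of positive degree would make it unbounded, so
  its values at \<open>t = 1\<close> and \<open>t = 0\<close> agree.\<close>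

lemma bounded_real_polynomial_function_constant:
  fixes p :: "'a::euclidean_space \<Rightarrow> real"
  assumes p: "real_polynomial_function p" and B: "\<And>x. \<bar>p x\<bar> \<le> B"
  shows "p x = p 0"
proof -
  have "polynomial_function (\<lambda>t::real. t *\<^sub>R x)"
    by (simp add: polynomial_function_bounded_linear bounded_linear_scaleR_left)
  then have "real_polynomial_function (p \<circ> (\<lambda>t. t *\<^sub>R x))"
    using p real_polynomial_function_compose by blast
  then obtain a n where a: "(p \<circ> (\<lambda>t. t *\<^sub>R x)) = (\<lambda>t. \<Sum>i\<le>n. a i * t ^ i)"
    unfolding real_polynomial_function_iff_sum by blast
  then have a': "p (t *\<^sub>R x) = (\<Sum>i\<le>n. a i * t ^ i)" for t
    by (metis comp_apply)
  have "a i = 0" if "i \<noteq> 0" "i \<le> n" for i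
  proof (rule ccontr)
    assume "a i \<noteq> 0"
    then have "eventually (\<lambda>t. norm (\<Sum>i\<le>n. a i * t ^ i) \<ge> B + 1) at_infinity"
      using that by (intro polyfun_extremal) auto
    then obtain t where "norm (\<Sum>i\<le>n. a i * t ^ i) \<ge> B + 1"
      using eventually_happens'[OF trivial_limit_at_infinity] by blast
    then show False using B[of "t *\<^sub>R x"] by (simp add: a')
  qed
  then have "(\<Sum>i\<le>n. a i * 1 ^ i) = (\<Sum>i\<le>n. a i * 0 ^ i)"
    by (intro sum.cong) (auto simp: power_0_left)
  then show ?thesis using a'[of 1] a'[of 0] by simp
qed

lemma uniform_nbhdD:
  assumes "g \<in> uniform_nbhd F f e"
  shows "\<bar>f x - g x\<bar> < e"
  using assms SUP_lessD[of "\<lambda>x. ereal \<bar>f x - g x\<bar>" UNIV "ereal e" x]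
  by (simp add: uniform_nbhd_def)

text \<open>The obstruction is a tuple of distinct coordinate functions: every tuple uniformly close
  to it is a translate by constants and so has a common zero, where no combination can equal 1. For
  \<open>k = 0\<close> the combination is the empty sum.\<close>

lemma not_unimodular_dense_polynomial_ring:
  assumes "k \<le> CARD('n)"
  shows "\<not> unimodular_dense (polynomial_ring :: (real ^ 'n \<Rightarrow> real) ring)
    (uniform_convergence_topology (carrier polynomial_ring)) k"
proof
  let ?R = "polynomial_ring :: (real ^ 'n \<Rightarrow> real) ring"
  assume dense: "unimodular_dense ?R (uniform_convergence_topology (carrier ?R)) k"
  obtain \<pi> :: "nat \<Rightarrow> 'n" where \<pi>: "inj_on \<pi> {..<k}"
    using assms card_le_inj[of "{..<k}" "UNIV :: 'n set"] by auto
  define f :: "nat \<Rightarrow> real ^ 'n \<Rightarrow> real" where "f = (\<lambda>j\<in>{..<k}. \<lambda>x. x $ \<pi> j)"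
  have f: "f \<in> {..<k} \<rightarrow>\<^sub>E carrier ?R"
    by (auto simp: f_def polynomial_ring_def bounded_linear_vec_nth intro: real_polynomial_function.intros)
  \<comment> \<open>The radius 1 is arbitrary; only boundedness of the differences matters.\<close>
  let ?U = "\<Pi>\<^sub>E j\<in>{..<k}. uniform_nbhd (carrier ?R) (f j) 1"
  have "openin (product_topology (\<lambda>_. uniform_convergence_topology (carrier ?R)) {..<k}) ?U"
    by (simp add: openin_PiE_gen openin_uniform_nbhd)
  moreover have "f j \<in> uniform_nbhd (carrier ?R) (f j) 1" if "j < k" for j
    using f that by (auto simp: uniform_nbhd_def)
  then have "f \<in> ?U" using f by (auto simp: PiE_def)
  ultimately obtain g where g: "g \<in> unimodular_tuples ?R k" "g \<in> ?U"
    using dense f unfolding unimodular_dense_def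
    by (metis (no_types, lifting) in_closure_of)
  have gR: "g \<in> {..<k} \<rightarrow>\<^sub>E carrier ?R" using g(1) by (simp add: unimodular_tuples_def)
  have const: "f j x - g j x = f j 0 - g j 0" if "j < k" for j x
  proof (rule bounded_real_polynomial_function_constant[where B = 1])
    show "real_polynomial_function (\<lambda>x. f j x - g j x)"
      using f gR that by (intro real_polynomial_function_diff) (auto simp: polynomial_ring_def)
    show "\<bar>f j x - g j x\<bar> \<le> 1" for x
      using g(2) that uniform_nbhdD[of "g j" _ "f j" 1 x] by fastforce
  qed
  \<comment> \<open>Since \<open>f j\<close> reads coordinate \<open>\<pi> j\<close>, placing the
    constant value of \<open>f j - g j\<close> there gives \<open>g j z = 0\<close>. Injectivity of
    \<open>\<pi>\<close> makes these choices compatible; coordinates outside its image may be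
    anything.\<close>
  define z :: "real ^ 'n" where
    "z = (\<chi> i. f (the_inv_into {..<k} \<pi> i) 0 - g (the_inv_into {..<k} \<pi> i) 0)"
  have "g j z = 0" if "j < k" for j
  proof -
    have "f j z = f j 0 - g j 0"
      using that by (simp add: f_def z_def the_inv_into_f_f[OF \<pi>])
    with const[OF that, of z] show ?thesis by simp
  qed
  moreover obtain y where "1 = (\<Sum>j<k. y j z * g j z)"
    using g(1) unfolding unimodular_tuples_polynomial_ring[OF gR] polynomial_combinations_def by blast
  ultimately show False by simp
qed

section \<open>Density for more than n entries, and the rank\<close>

lemma unimodular_dense_polynomial_ring:
  assumes "k > CARD('n)"
  shows "unimodular_dense (polynomial_ring :: (real ^ 'n \<Rightarrow> real) ring)
    (uniform_convergence_topology (carrier polynomial_ring)) k"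
proof -
  let ?R = "polynomial_ring :: (real ^ 'n \<Rightarrow> real) ring"
  let ?T = "product_topology (\<lambda>_. uniform_convergence_topology (carrier ?R)) {..<k}"
  have "f \<in> ?T closure_of unimodular_tuples ?R k" if f: "f \<in> {..<k} \<rightarrow>\<^sub>E carrier ?R" for f
    unfolding in_closure_of
  proof (intro conjI allI impI)
    show "f \<in> topspace ?T" using f by simp
    fix V assume V: "f \<in> V \<and> openin ?T V"
    then have "\<exists>U. finite {j \<in> {..<k}. U j \<noteq> topspace (uniform_convergence_topology (carrier ?R))} \<and>
        (\<forall>j\<in>{..<k}. openin (uniform_convergence_topology (carrier ?R)) (U j)) \<and>
        f \<in> Pi\<^sub>E {..<k} U \<and> Pi\<^sub>E {..<k} U \<subseteq> V"
      unfolding openin_product_topology_alt by blast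
    then obtain U where U: "\<And>j. j < k \<Longrightarrow> openin (uniform_convergence_topology (carrier ?R)) (U j)"
      "f \<in> Pi\<^sub>E {..<k} U" "Pi\<^sub>E {..<k} U \<subseteq> V"
      by auto
    have "\<exists>e>0. j < k \<longrightarrow> uniform_nbhd (carrier ?R) (f j) e \<subseteq> U j" for j
    proof (cases "j < k")
      case True
      then have "f j \<in> U j" using U(2) by auto
      with U(1)[OF True] show ?thesis
        unfolding openin_uniform_convergence_topology by blast
    qed (auto intro: exI[of _ 1])
    then obtain e where e: "\<And>j. e j > 0"
      "\<And>j. j < k \<Longrightarrow> uniform_nbhd (carrier ?R) (f j) (e j) \<subseteq> U j" by metis
    have k: "k > 0" using assms by simp
    \<comment> \<open>One radius serves all entries; the minimum is over a nonempty set because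
      \<open>k > 0\<close>.\<close>
    define d where "d = Min (e ` {..<k})"
    have "d > 0" using e(1) k unfolding d_def by (subst Min_gr_iff) auto
    have poly: "real_polynomial_function (f j)" if "j < k" for j
      using f that by (auto simp: polynomial_ring_def)
    obtain c where c: "\<forall>j<k. \<bar>c j\<bar> < d"
      "(\<lambda>_. 1) \<in> polynomial_combinations k (\<lambda>j x. f j x - c j)"
      using one_in_polynomial_combinations_small_shift[of k f d] poly assms \<open>d > 0\<close> by blast
    define g where "g = (\<lambda>j\<in>{..<k}. \<lambda>x. f j x - c j)"
    have g: "g \<in> {..<k} \<rightarrow>\<^sub>E carrier ?R"
      using poly by (auto simp: g_def polynomial_ring_def intro!: real_polynomial_function_diff
          real_polynomial_function.intros(2))
    have "(\<lambda>_. 1) \<in> polynomial_combinations k g"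
      using c(2) by (simp add: polynomial_combinations_def g_def)
    then have "g \<in> unimodular_tuples ?R k" using unimodular_tuples_polynomial_ring[OF g] by blast
    moreover have "g j \<in> U j" if "j < k" for j
    proof -
      have "d \<le> e j" using that by (auto simp: d_def)
      \<comment> \<open>The difference \<open>f j - g j\<close> is the constant \<open>c j\<close>,
        so the supremum is just its absolute value.\<close>
      then have "g j \<in> uniform_nbhd (carrier ?R) (f j) (e j)"
        using c(1) g that by (auto simp: uniform_nbhd_def g_def)
      then show ?thesis using e(2) that by blast
    qed
    then have "g \<in> V" using g U(3) by (auto simp: PiE_def)
    ultimately show "\<exists>y. y \<in> unimodular_tuples ?R k \<and> y \<in> V" by blast
  qed
  moreover have "?T closure_of unimodular_tuples ?R k \<subseteq> {..<k} \<rightarrow>\<^sub>E carrier ?R"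
    using closure_of_subset_topspace[of ?T] by simp
  ultimately show ?thesis unfolding unimodular_dense_def by blast
qed

theorem theorem6p2:
  "topological_stable_rank
     (polynomial_ring :: (real ^ 'n \<Rightarrow> real) ring)
     (uniform_convergence_topology (carrier polynomial_ring))
   = enat (CARD('n) + 1)"
proof -
  let ?D = "unimodular_dense (polynomial_ring :: (real ^ 'n \<Rightarrow> real) ring)
     (uniform_convergence_topology (carrier polynomial_ring))"
  have D: "?D k \<longleftrightarrow> k > CARD('n)" for k
    using not_unimodular_dense_polynomial_ring unimodular_dense_polynomial_ring
    by (metis not_le)
  have "(LEAST k. k \<ge> 1 \<and> ?D k) = CARD('n) + 1"
    unfolding D by (rule Least_equality) auto
  moreover have "\<exists>k\<ge>1. ?D k" unfolding D by (intro exI[of _ "CARD('n) + 1"]) simp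
  ultimately show ?thesis unfolding topological_stable_rank_def by simp
qed

end
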